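(* Let $\mathcal{Q}$ be a quaternion division algebra over a field $\mathbb{F}$. Let $V$ be a $2$-dimensional right $\mathcal{Q}$-vector space, and $u$ be a $\mathcal{Q}$-linear endomorphism of $V$. The following conditions are equivalent: (i) $u$ is the sum of two nilpotent endomorphisms of $V$; (ii) $u$ is represented, in some basis of $V$, by a matrix with all diagonal entries zero; (iii) $u^2$ is unispectral and diagonalisable, and if $u$ is unispectral and diagonalisable then either $u=0$ or the eigenvalues of $u$ are noncentral pure quaternions.
   Context: $\mathbb{F}$ is an arbitrary field (characteristic $2$ allowed). A quaternion division algebra over $\mathbb{F}$ is a $4$-dimensional associative unital $\mathbb{F}$-algebra with center $\mathbb{F}$ that is a division ring. It carries the quaternionic conjugation $q\mapsto\overline{q}$, the unique involutory $\mathbb{F}$-linear antiautomorphism such that $q\overline{q}=\overline{q}q\in\mathbb{F}$ for all $q$; the reduced trace is $t(q):=q+\overline{q}\in\mathbb{F}$. A quaternion $q$ is pure if $t(q)=0$, and noncentral if $q\notin\mathbb{F}$. The matrix $(m_{i,j})$ of $u$ in a basis $(e_1,\dots,e_n)$ is given by $u(e_j)=\sum_i e_i m_{i,j}$. An eigenvalue of $u$ is a $q\in\mathcal{Q}$ for which there is a nonzero vector $x$ (an eigenvector) with $u(x)=xq$. The set of eigenvalues is a union of conjugacy classes of $\mathcal{Q}$; an endomorphism is unispectral if its eigenvalues form exactly one conjugacy class. An endomorphism is diagonalisable if the space has a basis of its eigenvectors. *)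

theory Defs
  imports Complex_Main
begin

text \<open>
  A quaternion division algebra over the field \<open>'f\<close>, carried by the division ring \<open>'q\<close>.
  The field embeds as the scalar multiples of \<open>1\<close>. A nonzero \<open>dim\<close> forces a finite basis.
\<close>

locale quaternion_division_algebra = vector_space scale
  for scale :: "'f::field \<Rightarrow> 'q::division_ring \<Rightarrow> 'q" +
  assumes scale_mult_left: "scale a x * y = scale a (x * y)"
    and scale_mult_right: "x * scale a y = scale a (x * y)"
    and dim_eq_4: "dim UNIV = 4"
    and center_eq: "{z. \<forall>q. z * q = q * z} = range (\<lambda>a. scale a 1)"
begin

definition scalars :: "'q set"
  where "scalars = range (\<lambda>a. scale a 1)"

definition is_conjugation :: "('q \<Rightarrow> 'q) \<Rightarrow> bool"
  where "is_conjugation c \<longleftrightarrow>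
    Vector_Spaces.linear scale scale c \<and>
    (\<forall>p q. c (p * q) = c q * c p) \<and>
    (\<forall>q. c (c q) = q) \<and>
    (\<forall>q. q * c q = c q * q \<and> q * c q \<in> scalars)"

text \<open>
  Quaternionic conjugation is unique: \<open>(q + 1) * c (q + 1) \<in> scalars\<close> gives
  \<open>q + c q \<in> scalars\<close>, so for \<open>q \<notin> scalars\<close> the minimal polynomial of \<open>q\<close> determines
  \<open>c q\<close>, while \<open>c\<close> fixes the scalars.
\<close>

definition qconj :: "'q \<Rightarrow> 'q"
  where "qconj = (THE c. is_conjugation c)"

definition reduced_trace :: "'q \<Rightarrow> 'q"
  where "reduced_trace q = q + qconj q"

definition pure :: "'q \<Rightarrow> bool"
  where "pure q \<longleftrightarrow> reduced_trace q = 0"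

definition noncentral :: "'q \<Rightarrow> bool"
  where "noncentral q \<longleftrightarrow> q \<notin> scalars"

end

definition conj_class :: "'q::division_ring \<Rightarrow> 'q set"
  where "conj_class q = {s * q * inverse s | s. s \<noteq> 0}"

definition nilpotent :: "('v::zero \<Rightarrow> 'v) \<Rightarrow> bool"
  where "nilpotent a \<longleftrightarrow> (\<exists>k. a ^^ k = (\<lambda>x. 0))"

text \<open>
  The vector spaces of the library are left modules over commutative rings, hence the
  following notions for right vector spaces over a division ring.
\<close>

locale right_vector_space =
  fixes rscale :: "'v::ab_group_add \<Rightarrow> 'q::division_ring \<Rightarrow> 'v"  (infixl "\<bullet>" 75)
  assumes add_rscale: "(x + y) \<bullet> q = x \<bullet> q + y \<bullet> q"
    and rscale_add: "x \<bullet> (p + q) = x \<bullet> p + x \<bullet> q"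
    and rscale_rscale: "(x \<bullet> p) \<bullet> q = x \<bullet> (p * q)"
    and rscale_one: "x \<bullet> 1 = x"
begin

text \<open>Only finite bases are considered; they are families indexed by \<open>{..<n}\<close>.\<close>

definition is_basis :: "nat \<Rightarrow> (nat \<Rightarrow> 'v) \<Rightarrow> bool"
  where "is_basis n e \<longleftrightarrow>
    (\<forall>x. \<exists>c. x = (\<Sum>i<n. e i \<bullet> c i)) \<and>
    (\<forall>c. (\<Sum>i<n. e i \<bullet> c i) = 0 \<longrightarrow> (\<forall>i<n. c i = 0))"

definition has_dimension :: "nat \<Rightarrow> bool"
  where "has_dimension n \<longleftrightarrow> (\<exists>e. is_basis n e)"

definition endomorphism :: "('v \<Rightarrow> 'v) \<Rightarrow> bool"
  where "endomorphism u \<longleftrightarrow>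
    (\<forall>x y. u (x + y) = u x + u y) \<and> (\<forall>x q. u (x \<bullet> q) = u x \<bullet> q)"

definition is_matrix_of :: "nat \<Rightarrow> (nat \<Rightarrow> 'v) \<Rightarrow> ('v \<Rightarrow> 'v) \<Rightarrow> (nat \<Rightarrow> nat \<Rightarrow> 'q) \<Rightarrow> bool"
  where "is_matrix_of n e u m \<longleftrightarrow> (\<forall>j<n. u (e j) = (\<Sum>i<n. e i \<bullet> m i j))"

definition eigenvector :: "('v \<Rightarrow> 'v) \<Rightarrow> 'v \<Rightarrow> bool"
  where "eigenvector u x \<longleftrightarrow> x \<noteq> 0 \<and> (\<exists>q. u x = x \<bullet> q)"

definition eigenvalues :: "('v \<Rightarrow> 'v) \<Rightarrow> 'q set"
  where "eigenvalues u = {q. \<exists>x. x \<noteq> 0 \<and> u x = x \<bullet> q}"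

definition unispectral :: "('v \<Rightarrow> 'v) \<Rightarrow> bool"
  where "unispectral u \<longleftrightarrow> (\<exists>q. eigenvalues u = conj_class q)"

definition diagonalisable :: "('v \<Rightarrow> 'v) \<Rightarrow> bool"
  where "diagonalisable u \<longleftrightarrow> (\<exists>n e. is_basis n e \<and> (\<forall>i<n. eigenvector u (e i)))"

end

end

theory Submission
  imports Defs
begin

text \<open>
  For operators \<open>a\<close>, \<open>b\<close> on a plane that are nilpotent, each has a kernel line containing its
  image; so \<open>a + b\<close> maps one kernel line into the other and conversely, unless the two lines
  coincide. Hence (i) and (ii) both say that there are independent \<open>x\<close>, \<open>y\<close> with
  \<open>u x \<in> y Q\<close> and \<open>u y \<in> x Q\<close>. Then \<open>u\<^sup>2\<close> has the conjugate eigenvalues \<open>b c\<close> and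
  \<open>c b\<close>. Conversely, an eigenvector \<open>v\<close> of \<open>u\<^sup>2\<close> that is not one of \<open>u\<close> gives such a
  pair \<open>v\<close>, \<open>u v\<close>. If there is none, \<open>u\<close> is unispectral and diagonalisable with an eigenvalue
  \<open>q\<close>; when \<open>q\<close> is noncentral and pure, \<open>q\<^sup>2\<close> is central, so every vector is an eigenvector
  of \<open>u\<^sup>2\<close> and hence of \<open>u\<close>, which contradicts the noncentrality of \<open>q\<close>.

  Conjugation is constructed uniformly in all characteristics. A suitable commutator
  \<open>j = x q - q x\<close> does not commute with \<open>q\<close>; conjugation by \<open>j\<close> is then the nontrivial
  automorphism of the quadratic field \<open>K = C(q)\<close> (the centraliser), the algebra is
  \<open>K + K j\<close>, and quaternionic conjugation sends \<open>a + b j\<close> to \<open>j a j\<inverse> - b j\<close>.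
\<close>

section \<open>Quaternionic conjugation\<close>

context quaternion_division_algebra
begin

section \<open>Scalars and centralisers of noncentral elements\<close>

lemma scalars_iff: "z \<in> scalars \<longleftrightarrow> (\<forall>q. z * q = q * z)"
  unfolding scalars_def center_eq[symmetric] by simp

lemma scalars_commute: "z \<in> scalars \<Longrightarrow> z * q = q * z"
  by (simp add: scalars_iff)

lemma scale_one_in_scalars: "scale a 1 \<in> scalars"
  by (simp add: scalars_def)

lemma independent_card_le_4:
  assumes "independent B"
  shows "finite B \<and> card B \<le> 4"
proof -
  obtain T where T: "UNIV \<subseteq> span T" "card T = dim UNIV"
    by (rule basis_exists)
  then have "card T = 4" by (simp add: dim_eq_4)
  then have "finite T" by (intro card_ge_0_finite) simp
  then show ?thesis using independent_span_bound[of T B] assms T \<open>card T = 4\<close> by auto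
qed

text \<open>The centraliser \<open>C\<close> of \<open>q\<close> is a proper subspace, missing some
  \<open>x\<close>. If \<open>z\<close> were independent of \<open>1\<close> and \<open>q\<close>,
  then \<open>1\<close>, \<open>q\<close>, \<open>z\<close>, \<open>x\<close>, \<open>x * q\<close>
  would be five independent elements in dimension 4.\<close>

lemma commute_in_span:
  assumes q: "q \<notin> scalars" and z: "z * q = q * z"
  obtains a b where "a \<in> scalars" "b \<in> scalars" "z = a + b * q"
proof -
  obtain x where x: "x * q \<noteq> q * x" using q by (metis scalars_iff)
  define C where "C = {w. w * q = q * w}"
  have sub: "subspace C"
    unfolding subspace_def C_def by (simp add: distrib_left distrib_right scale_mult_left scale_mult_right)
  have C1: "1 \<in> C" "q \<in> C" "z \<in> C" using z by (auto simp: C_def)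
  have xC: "x \<notin> C" using x by (simp add: C_def)
  have "z \<in> span {q, 1}"
  proof (rule ccontr)
    assume nz: "z \<notin> span {q, 1}"
    have i1: "independent {1::'q}" by simp
    have q1: "q \<notin> span {1}"
      using q by (auto simp: span_singleton scalars_def)
    have spC: "span {z, q, 1} \<subseteq> C" using C1 sub by (intro span_minimal) auto
    have x3: "x \<notin> span {z, q, 1}" using spC xC by auto
    \<comment> \<open>A relation would put \<open>x * (q - scale k 1)\<close> into \<open>C\<close>;
      the factor \<open>q - scale k 1\<close> is nonzero and lies in \<open>C\<close>, so cancelling
      it would put \<open>x\<close> into \<open>C\<close>.\<close>
    have xq: "x * q \<notin> span {x, z, q, 1}"
    proof
      assume "x * q \<in> span {x, z, q, 1}"
      then obtain k where k: "x * q - scale k x \<in> span {z, q, 1}"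
        unfolding span_insert[of x] by blast
      then have "x * (q - scale k 1) \<in> C"
        using spC by (auto simp: right_diff_distrib scale_mult_right)
      moreover have d: "q - scale k 1 \<noteq> 0" using q scale_one_in_scalars by auto
      moreover have dc: "(q - scale k 1) * q = q * (q - scale k 1)"
        by (simp add: left_diff_distrib right_diff_distrib scale_mult_left scale_mult_right)
      ultimately have "x * q * (q - scale k 1) = q * x * (q - scale k 1)"
        by (simp add: C_def mult.assoc)
      then show False using x d by simp
    qed
    have ind: "independent {x * q, x, z, q, 1}"
      by (intro independent_insertI xq x3 nz q1 i1)
    have dist: "x * q \<notin> {x, z, q, 1}" "x \<notin> {z, q, 1}" "z \<notin> {q, 1}" "q \<notin> {1}"
      using xq x3 nz q1 span_base by metis+
    have "card {x * q, x, z, q, 1} = 5" using dist by simp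
    then show False using independent_card_le_4[OF ind] by simp
  qed
  then obtain b a where "z - scale b q = scale a 1"
    unfolding span_insert[of q] span_singleton by blast
  then have "z = scale a 1 + scale b 1 * q" by (simp add: scale_mult_left algebra_simps)
  then show ?thesis using that scale_one_in_scalars by blast
qed

lemma centraliser_commutative:
  assumes q: "q \<notin> scalars" and "x * q = q * x" "y * q = q * y"
  shows "x * y = y * x"
proof -
  obtain a b where ab: "a \<in> scalars" "b \<in> scalars" "x = a + b * q"
    using commute_in_span assms by metis
  have "b * q * y = b * y * q" using assms by (simp add: mult.assoc)
  also have "\<dots> = y * (b * q)" using scalars_commute[OF ab(2), of y] by (simp add: mult.assoc)
  finally show ?thesis using ab scalars_commute[of a y] by (simp add: distrib_left distrib_right)
qed

text \<open>
  If \<open>[x, q]\<close> commuted with both \<open>x\<close> and \<open>q\<close>, then \<open>[x * q, q] = [x, q] * q\<close> would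
  not commute with \<open>x * q\<close>. In characteristic 2 this excludes inseparable \<open>q\<close>.
\<close>

lemma exists_separable:
  obtains q x :: 'q where "(x * q - q * x) * q \<noteq> q * (x * q - q * x)"
proof -
  have "\<exists>q. q \<notin> scalars"
  proof (rule ccontr)
    assume "\<nexists>q. q \<notin> scalars"
    then have "UNIV \<subseteq> span {1}" by (auto simp: scalars_def span_singleton)
    then have "dim UNIV \<le> 1" using dim_le_card[of UNIV "{1}"] by simp
    then show False by (simp add: dim_eq_4)
  qed
  then obtain x q :: 'q where xq: "x * q \<noteq> q * x" unfolding scalars_iff by blast
  define j where "j = x * q - q * x"
  have j0: "j \<noteq> 0" using xq by (simp add: j_def)
  have q0: "q \<noteq> 0" using xq by force
  consider "j * q \<noteq> q * j" | "j * x \<noteq> x * j" | "j * q = q * j" "j * x = x * j" by blast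
  then show thesis
  proof cases
    case 1 then show thesis using that[of x q] by (simp add: j_def)
  next
    case 2
    moreover have "q * x - x * q = - j" by (simp add: j_def)
    ultimately show thesis using that[of q x] by simp
  next
    case 3
    have "q * (x * q) - (x * q) * q = - (j * q)" by (simp add: j_def algebra_simps)
    moreover have "- (j * q) * (x * q) \<noteq> (x * q) * (- (j * q))"
    proof
      assume "- (j * q) * (x * q) = (x * q) * (- (j * q))"
      then have "j * (q * x) * q = x * (q * j) * q" by (simp add: mult.assoc)
      then have "j * (q * x) = x * (q * j)" using q0 by simp
      also have "\<dots> = j * (x * q)" using 3 by (metis mult.assoc)
      finally show False using j0 xq by simp
    qed
    ultimately show thesis using that[of q "x * q"] by simp
  qed
qed

section \<open>Existence of quaternionic conjugation\<close>

lemma scalars_diff: "a \<in> scalars \<Longrightarrow> b \<in> scalars \<Longrightarrow> a - b \<in> scalars"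
  by (simp add: scalars_iff left_diff_distrib right_diff_distrib)

lemma scalars_mult:
  assumes "a \<in> scalars" "b \<in> scalars"
  shows "a * b \<in> scalars"
  using assms unfolding scalars_iff by (metis mult.assoc)

lemma scalars_inverse:
  assumes "a \<in> scalars"
  shows "inverse a \<in> scalars"
  using assms mult_commute_imp_mult_inverse_commute unfolding scalars_iff by blast

text \<open>The commutator of \<open>x\<close> with \<open>q * q\<close> is
  \<open>y * q + q * y\<close>, and it is also \<open>t * y\<close> because \<open>n\<close> and
  \<open>t\<close> are central. Here \<open>t - q\<close> is the second root of the quadratic
  equation of \<open>q\<close>.\<close>

lemma commutator_intertwines:
  fixes q x :: 'q
  assumes "n \<in> scalars" "t \<in> scalars" "q * q = n + t * q"
  defines "y \<equiv> x * q - q * x"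
  shows "y * q = (t - q) * y" and "y * (t - q) = q * y"
proof -
  have 1: "x * (q * q) = n * x + t * (x * q)" and 2: "q * (q * x) = n * x + t * (q * x)"
    using scalars_commute[OF assms(1), of x] scalars_commute[OF assms(2), of x] assms(3)
    by (simp_all add: distrib_left distrib_right flip: mult.assoc)
  show 3: "y * q = (t - q) * y"
    unfolding y_def using 1 2 by (simp add: left_diff_distrib right_diff_distrib mult.assoc)
  show "y * (t - q) = q * y"
    using 3 scalars_commute[OF assms(2), of y] by (simp add: left_diff_distrib right_diff_distrib)
qed

lemma exists_conjugation: "\<exists>c. is_conjugation c"
proof -
  obtain q x :: 'q where "(x * q - q * x) * q \<noteq> q * (x * q - q * x)"
    by (rule exists_separable)
  define j where "j = x * q - q * x"
  have jq: "j * q \<noteq> q * j" unfolding j_def by fact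
  have q: "q \<notin> scalars" using jq scalars_commute by metis
  obtain n t where nt: "n \<in> scalars" "t \<in> scalars" "q * q = n + t * q"
    using commute_in_span[OF q, of "q * q"] by (metis mult.assoc)
  define k where "k = t - q"
  define C where "C = (\<lambda>w. w * q = q * w)"
  have C_comm: "v * w = w * v" if "C v" "C w" for v w
    using centraliser_commutative[OF q] that by (simp add: C_def)
  have Cmult: "C (v * w)" if "C v" "C w" for v w
    using that unfolding C_def by (metis mult.assoc)
  have Cadd: "C (v + w)" if "C v" "C w" for v w
    using that unfolding C_def by (simp add: distrib_left distrib_right)
  have Ck: "C k" using scalars_commute[OF nt(2), of q]
    by (simp add: C_def k_def left_diff_distrib right_diff_distrib)
  have jq': "j * q = k * j" and jk: "j * k = q * j"
    using commutator_intertwines[OF nt, of x] by (simp_all add: j_def k_def)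
  have j0: "j \<noteq> 0" using jq by force
  have qk: "q - k \<noteq> 0" using jq jq' by auto
  \<comment> \<open>Together with \<open>C\<close>, the element \<open>j\<close> generates the
    algebra. Commutation of \<open>a + b * q\<close> with \<open>j\<close> forces
    \<open>b = 0\<close>, since \<open>j\<close> does not commute with \<open>q\<close>.\<close>
  have central: "z \<in> scalars" if z: "C z" "z * j = j * z" for z
  proof -
    obtain a b where ab: "a \<in> scalars" "b \<in> scalars" "z = a + b * q"
      using commute_in_span[OF q] z unfolding C_def by metis
    have "j * (b * q) = b * (j * q)"
      using scalars_commute[OF ab(2), of j] by (simp flip: mult.assoc)
    then have "b * (q * j - j * q) = 0" using z(2) ab scalars_commute[OF ab(1), of j]
      by (simp add: distrib_left distrib_right right_diff_distrib mult.assoc)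
    then show ?thesis using jq ab by auto
  qed
  \<comment> \<open>\<open>j\<close> exchanges \<open>q\<close> and \<open>k\<close>, so its square
    commutes with \<open>q\<close> as well as with \<open>j\<close>.\<close>
  have jj: "j * j \<in> scalars"
  proof (rule central)
    show "C (j * j)" unfolding C_def using jq' jk by (metis mult.assoc)
  qed (simp add: mult.assoc)
  then have Cjj: "C (j * j)" unfolding C_def by (rule scalars_commute)
  \<comment> \<open>The nontrivial automorphism of \<open>C\<close>, extended to the whole algebra;
    it is an involution because \<open>j * j\<close> is central.\<close>
  define s where "s = (\<lambda>w. j * w * inverse j)"
  have js: "j * w = s w * j" for w using j0 by (simp add: s_def mult.assoc)
  have yjw: "y * j * w = y * s w * j" for y w by (simp only: mult.assoc js)
  have s_mult: "s (v * w) = s v * s w" for v w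
  proof -
    have "s v * s w * j = s v * (j * w)" by (simp add: js mult.assoc)
    also have "\<dots> = s (v * w) * j" by (simp add: js[symmetric] flip: mult.assoc)
    finally have "s v * s w * j = s (v * w) * j" .
    then show ?thesis using j0 by simp
  qed
  have s_add: "s (v + w) = s v + s w" for v w
    by (simp add: s_def distrib_left distrib_right)
  have s_scalar: "s w = w" if "w \<in> scalars" for w
    using js[of w] scalars_commute[OF that, of j] j0 by simp
  have s_s: "s (s w) = w" for w
  proof -
    have "s (s w) * (j * j) = j * j * w" using js by (metis mult.assoc)
    also have "\<dots> = w * (j * j)" by (rule scalars_commute[OF jj])
    finally show ?thesis using j0 by simp
  qed
  have s_C: "C (s w)" if w: "C w" for w
  proof -
    have "s w * q * j = s w * j * k" by (simp only: mult.assoc jk)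
    also have "\<dots> = j * (w * k)" unfolding js[symmetric] by (rule mult.assoc)
    also have "\<dots> = j * k * w" by (simp only: C_comm[OF w Ck] mult.assoc)
    also have "\<dots> = q * s w * j" unfolding jk by (simp only: js mult.assoc)
    finally show ?thesis using j0 by (simp add: C_def)
  qed
  have s_norm: "w * s w \<in> scalars" if w: "C w" for w
  proof (rule central)
    show "C (w * s w)" by (intro Cmult s_C w)
    show "w * s w * j = j * (w * s w)"
      using C_comm[OF w s_C[OF w]] by (simp add: js s_mult s_s)
  qed
  \<comment> \<open>The projection onto \<open>C j\<close> along \<open>C\<close>: the commutator of
    \<open>a + b * j\<close> with \<open>q\<close> is \<open>b * j * (q - k)\<close>, and the right
    factor is then divided out.\<close>
  define P where "P = (\<lambda>x. (x * q - q * x) * inverse (q - k))"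
  have inv_qk: "C (inverse (q - k))"
    unfolding C_def
    by (rule mult_commute_imp_mult_inverse_commute) (use Ck in \<open>simp add: C_def left_diff_distrib right_diff_distrib\<close>)
  have P_eq: "P (a + b * j) = b * j" if "C a" "C b" for a b
  proof -
    have "(a + b * j) * q - q * (a + b * j) = b * (j * q) - q * b * j"
      using that by (simp add: C_def distrib_left distrib_right mult.assoc)
    also have "\<dots> = b * (j * q) - b * (j * k)"
      using that by (simp add: C_def jk flip: mult.assoc)
    finally show ?thesis using qk
      by (simp add: P_def mult.assoc flip: right_diff_distrib)
  qed
  have decomp: "\<exists>a b. C a \<and> C b \<and> x = a + b * j" for x
  proof -
    \<comment> \<open>The part of \<open>x\<close> in \<open>C j\<close> is \<open>y * i\<close>,
      that is \<open>P x\<close>. As \<open>y\<close> satisfies the same relations with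
      \<open>q\<close> and \<open>k\<close> as \<open>j\<close>, the quotient
      \<open>y * i * inverse j\<close> lies in \<open>C\<close>; and \<open>y * i\<close> has the
      same commutator with \<open>q\<close> as \<open>x\<close>, so the difference lies in
      \<open>C\<close> too.\<close>
    define y where "y = x * q - q * x"
    have yq: "y * q = k * y" and yk: "y * k = q * y"
      using commutator_intertwines[OF nt, of x] by (simp_all add: y_def k_def)
    define i where "i = inverse (q - k)"
    have Ci: "i * q = q * i" "i * k = k * i" using inv_qk C_comm[OF inv_qk Ck] by (auto simp: C_def i_def)
    have "C (y * i * inverse j)"
    proof -
      have "inverse j * (q * j) * inverse j = inverse j * (j * k) * inverse j" by (simp add: jk)
      then have "inverse j * q = k * inverse j" using j0 by (simp add: mult.assoc) (simp flip: mult.assoc)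
      then have "y * i * inverse j * q = y * (i * k) * inverse j" by (simp add: mult.assoc)
      also have "\<dots> = q * y * i * inverse j" by (simp add: Ci yk flip: mult.assoc)
      finally show ?thesis by (simp add: C_def mult.assoc)
    qed
    moreover have "C (x - y * i)"
    proof -
      have "y * i * q - q * (y * i) = y * q * i - y * k * i" by (simp add: Ci yk mult.assoc)
      also have "\<dots> = y * (q - k) * i" by (simp add: left_diff_distrib right_diff_distrib)
      also have "\<dots> = x * q - q * x" using qk by (simp add: i_def y_def mult.assoc)
      finally show ?thesis by (simp add: C_def left_diff_distrib right_diff_distrib algebra_simps)
    qed
    moreover have "x = (x - y * i) + (y * i * inverse j) * j" using j0 by (simp add: mult.assoc)
    ultimately show ?thesis by blast
  qed
  \<comment> \<open>Going through \<open>P\<close> makes \<open>c\<close> visibly linear without a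
    choice of coordinates; \<open>c_eq\<close> then gives the formula in coordinates.\<close>
  define c where "c = (\<lambda>x. s (x - P x) - P x)"
  have c_eq: "c (a + b * j) = s a - b * j" if "C a" "C b" for a b
    using P_eq[OF that] by (simp add: c_def)
  have lin: "Vector_Spaces.linear scale scale c"
    unfolding Vector_Spaces.linear_iff
    by (auto simp: vector_space_axioms c_def s_def P_def scale_mult_left scale_mult_right
        scale_right_diff_distrib algebra_simps)
  \<comment> \<open>Both sides are expanded in \<open>C + C j\<close>: \<open>yjw\<close> moves
    \<open>j\<close> to the right at the price of \<open>s\<close>, and the coefficients commute
    with each other.\<close>
  have anti: "c (p * r) = c r * c p" for p r
  proof -
    obtain a b where p: "C a" "C b" "p = a + b * j" using decomp by blast
    obtain g d where r: "C g" "C d" "r = g + d * j" using decomp by blast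
    have "p * r = (a * g + b * s d * (j * j)) + (a * d + b * s g) * j"
      unfolding p r by (simp only: distrib_left distrib_right yjw add_ac mult.assoc[symmetric])
    also have "c \<dots> = s (a * g + b * s d * (j * j)) - (a * d + b * s g) * j"
      by (intro c_eq Cadd Cmult s_C p r Cjj)
    also have "\<dots> = s a * s g + s b * d * (j * j) - (a * d + b * s g) * j"
      by (simp add: s_add s_mult s_s s_scalar[OF jj, unfolded s_mult])
    also have "\<dots> = s g * s a + d * s b * (j * j) - (d * a + s g * b) * j"
      using p r by (simp add: C_comm s_C)
    also have "\<dots> = (s g - d * j) * (s a - b * j)"
      by (simp add: left_diff_distrib right_diff_distrib distrib_right yjw s_s flip: mult.assoc)
    also have "\<dots> = c r * c p" by (simp add: c_eq p r)
    finally show ?thesis .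
  qed
  have invol: "c (c p) = p" for p
  proof -
    obtain a b where p: "C a" "C b" "p = a + b * j" using decomp by blast
    have "C (- b)" using p by (simp add: C_def)
    then show ?thesis using c_eq[OF s_C[OF p(1)], of "- b"] by (simp add: c_eq p s_s)
  qed
  \<comment> \<open>Both products equal \<open>a * s a - b * s b * (j * j)\<close>, a combination of
    the central norms of \<open>a\<close> and \<open>b\<close>.\<close>
  have norm: "p * c p = c p * p \<and> p * c p \<in> scalars" for p
  proof -
    obtain a b where p: "C a" "C b" "p = a + b * j" using decomp by blast
    have cp: "c p = s a - b * j" using c_eq p by simp
    have 1: "p * c p = a * s a - b * s b * (j * j)"
      unfolding cp unfolding p(3) using C_comm[OF p(1,2)]
      by (simp add: left_diff_distrib right_diff_distrib distrib_right yjw s_s flip: mult.assoc)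
    have 2: "c p * p = a * s a - b * s b * (j * j)"
      unfolding cp unfolding p(3) using C_comm[OF p(1) s_C[OF p(1)]] C_comm[OF p(2) s_C[OF p(1)]]
      by (simp add: left_diff_distrib distrib_right distrib_left yjw flip: mult.assoc)
    show ?thesis using 1 2 s_norm p jj by (simp add: scalars_diff scalars_mult)
  qed
  show ?thesis unfolding is_conjugation_def using lin anti invol norm by blast
qed

section \<open>Uniqueness of quaternionic conjugation\<close>

lemma conjugation_scalar:
  assumes c: "is_conjugation c" and z: "z \<in> scalars"
  shows "c z = z"
proof -
  interpret c: Vector_Spaces.linear scale scale c using c by (simp add: is_conjugation_def)
  have "c (1 * c 1) = c (c 1) * c 1" using c unfolding is_conjugation_def by blast
  then have "c 1 = 1" using c unfolding is_conjugation_def by simp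
  then show ?thesis using z c.scale by (auto simp: scalars_def)
qed

lemma conjugation_trace:
  assumes c: "is_conjugation c"
  shows "q + c q \<in> scalars"
proof -
  interpret c: Vector_Spaces.linear scale scale c using c by (simp add: is_conjugation_def)
  have 1: "c 1 = 1" using conjugation_scalar[OF c] scale_one_in_scalars[of 1] by simp
  have "(q + 1) * c (q + 1) - q * c q - 1 \<in> scalars"
    using c scale_one_in_scalars[of 1] unfolding is_conjugation_def
    by (intro scalars_diff) (blast | simp)+
  then show ?thesis by (simp add: c.add 1 distrib_left distrib_right algebra_simps)
qed

text \<open>Traces and norms are central, so \<open>c q - d q\<close> and its product with
  \<open>q\<close> are both scalars. A nonzero difference could be divided out and would make
  \<open>q\<close> a scalar.\<close>

lemma conjugation_unique:
  assumes c: "is_conjugation c" and d: "is_conjugation d"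
  shows "c = d"
proof
  fix q
  show "c q = d q"
  proof (cases "q \<in> scalars")
    case True
    then show ?thesis using conjugation_scalar[OF c] conjugation_scalar[OF d] by simp
  next
    case False
    have "c q * q - d q * q \<in> scalars"
      using c d unfolding is_conjugation_def by (metis scalars_diff)
    then have n: "(c q - d q) * q \<in> scalars" by (simp add: left_diff_distrib)
    have "(q + c q) - (q + d q) \<in> scalars" using conjugation_trace c d by (intro scalars_diff)
    then have t: "c q - d q \<in> scalars" by simp
    have "c q - d q = 0"
    proof (rule ccontr)
      assume "c q - d q \<noteq> 0"
      then have "inverse (c q - d q) * ((c q - d q) * q) = q" by (simp flip: mult.assoc)
      then show False using False scalars_mult[OF scalars_inverse[OF t] n] by simp
    qed
    then show ?thesis by simp
  qed
qed

lemma is_conjugation_qconj: "is_conjugation qconj"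
  unfolding qconj_def using exists_conjugation conjugation_unique by (metis theI)

end

section \<open>Right vector spaces of dimension 2\<close>

context right_vector_space
begin

section \<open>Arithmetic of right scalar multiplication and endomorphisms\<close>

lemma zero_rscale [simp]: "0 \<bullet> q = 0"
  using add_rscale[of 0 0 q] by simp

lemma rscale_zero [simp]: "x \<bullet> 0 = 0"
  using rscale_add[of x 0 0] by simp

lemma rscale_minus [simp]: "x \<bullet> (- q) = - (x \<bullet> q)"
  using rscale_add[of x q "- q"] by (simp add: eq_neg_iff_add_eq_0 add.commute)

lemma minus_rscale [simp]: "(- x) \<bullet> q = - (x \<bullet> q)"
  using add_rscale[of x "- x" q] by (simp add: eq_neg_iff_add_eq_0 add.commute)

lemma rscale_diff: "x \<bullet> (p - q) = x \<bullet> p - x \<bullet> q"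
  using rscale_add[of x p "- q"] by simp

lemma diff_rscale: "(x - y) \<bullet> q = x \<bullet> q - y \<bullet> q"
  using add_rscale[of x "- y" q] by simp

lemma rscale_eq_0_iff [simp]: "x \<bullet> q = 0 \<longleftrightarrow> x = 0 \<or> q = 0"
proof
  assume "x \<bullet> q = 0"
  then have "x \<bullet> (q * inverse q) = 0" by (simp flip: rscale_rscale)
  then show "x = 0 \<or> q = 0" by (cases "q = 0") (auto simp: rscale_one)
qed auto

lemma endomorphism_add: "endomorphism u \<Longrightarrow> u (x + y) = u x + u y"
  by (simp add: endomorphism_def)

lemma endomorphism_rscale: "endomorphism u \<Longrightarrow> u (x \<bullet> q) = u x \<bullet> q"
  by (simp add: endomorphism_def)

lemma endomorphism_0: "endomorphism u \<Longrightarrow> u 0 = 0"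
  using endomorphism_rscale[of u 0 0] by simp

lemma endomorphism_comp: "endomorphism u \<Longrightarrow> endomorphism v \<Longrightarrow> endomorphism (u \<circ> v)"
  by (simp add: endomorphism_def)

section \<open>Independent pairs and the exchange argument\<close>

definition indep2 :: "'v \<Rightarrow> 'v \<Rightarrow> bool"
  where "indep2 x y \<longleftrightarrow> (\<forall>c d. x \<bullet> c + y \<bullet> d = 0 \<longrightarrow> c = 0 \<and> d = 0)"

lemma indep2_D: "indep2 x y \<Longrightarrow> x \<bullet> c + y \<bullet> d = 0 \<Longrightarrow> c = 0 \<and> d = 0"
  by (auto simp: indep2_def)

lemma indep2_nonzero:
  assumes "indep2 x y"
  shows "x \<noteq> 0" "y \<noteq> 0"
  using assms indep2_D[of x y 1 0] indep2_D[of x y 0 1] by auto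

lemma indep2_sym: "indep2 x y \<Longrightarrow> indep2 y x"
  unfolding indep2_def by (metis add.commute)

lemma indep2_coords:
  assumes "indep2 x y" "x \<bullet> a + y \<bullet> b = x \<bullet> c + y \<bullet> d"
  shows "a = c \<and> b = d"
proof -
  have "x \<bullet> (a - c) + y \<bullet> (b - d) = 0" using assms(2) by (simp add: rscale_diff algebra_simps)
  then show ?thesis using indep2_D[OF assms(1)] by fastforce
qed

lemma indep2_I:
  assumes x: "x \<noteq> 0" and y: "\<And>q. y \<noteq> x \<bullet> q"
  shows "indep2 x y"
  unfolding indep2_def
proof (intro allI impI)
  fix c d assume 0: "x \<bullet> c + y \<bullet> d = 0"
  have "d = 0"
  proof (rule ccontr)
    assume d: "d \<noteq> 0"
    have "y \<bullet> d = x \<bullet> (- c)" using 0 by (simp add: eq_neg_iff_add_eq_0 add.commute)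
    then have "y \<bullet> d \<bullet> inverse d = x \<bullet> (- c) \<bullet> inverse d" by simp
    then show False using d y[of "- c * inverse d"] by (simp add: rscale_rscale rscale_one)
  qed
  then show "c = 0 \<and> d = 0" using 0 x by simp
qed

lemma indep2_rscale:
  assumes "indep2 x y" "p \<noteq> 0" "q \<noteq> 0"
  shows "indep2 (x \<bullet> p) (y \<bullet> q)"
  unfolding indep2_def
proof (intro allI impI)
  fix c d assume "x \<bullet> p \<bullet> c + y \<bullet> q \<bullet> d = 0"
  then show "c = 0 \<and> d = 0"
    using indep2_D[OF assms(1), of "p * c" "q * d"] assms by (simp add: rscale_rscale)
qed

lemma is_basis_2_iff:
  "is_basis 2 e \<longleftrightarrow> indep2 (e 0) (e 1) \<and> (\<forall>v. \<exists>c d. v = e 0 \<bullet> c + e 1 \<bullet> d)"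
proof -
  \<comment> \<open>A coefficient family matters only through its values at 0 and 1, so quantifiers
    over families become quantifiers over pairs.\<close>
  have pair: "(\<exists>c. P (c (0::nat)) (c 1)) \<longleftrightarrow> (\<exists>a b. P a b)" for P :: "'q \<Rightarrow> 'q \<Rightarrow> bool"
  proof
    assume "\<exists>a b. P a b"
    then obtain a b where "P a b" by blast
    then show "\<exists>c. P (c (0::nat)) (c 1)" by (intro exI[of _ "\<lambda>i::nat. if i = 0 then a else b"]) simp
  qed auto
  have pair': "(\<forall>c. P (c (0::nat)) (c 1)) \<longleftrightarrow> (\<forall>a b. P a b)" for P :: "'q \<Rightarrow> 'q \<Rightarrow> bool"
    using pair[of "\<lambda>a b. \<not> P a b"] by blast
  have sum2: "(\<Sum>i<2. e i \<bullet> c i) = e 0 \<bullet> c 0 + e 1 \<bullet> c 1" for c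
    by (simp add: numeral_2_eq_2)
  have all2: "(\<forall>i<2. c i = 0) \<longleftrightarrow> c 0 = 0 \<and> c 1 = 0" for c :: "nat \<Rightarrow> 'q"
    by (auto simp: less_2_cases_iff)
  show ?thesis
    unfolding is_basis_def indep2_def sum2 all2
    using pair[of "\<lambda>a b. v = e 0 \<bullet> a + e 1 \<bullet> b" for v]
      pair'[of "\<lambda>a b. e 0 \<bullet> a + e 1 \<bullet> b = 0 \<longrightarrow> a = 0 \<and> b = 0"]
    by auto
qed

lemma dimension_2_basis:
  assumes "has_dimension 2"
  obtains x y where "indep2 x y" "\<And>v. \<exists>c d. v = x \<bullet> c + y \<bullet> d"
  using assms unfolding has_dimension_def is_basis_2_iff by blast

text \<open>One Steinitz step: independence from \<open>y\<close> gives \<open>w\<close> a nonzero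
  coordinate along \<open>x\<close>, so \<open>x\<close> can be solved for in terms of
  \<open>w\<close> and \<open>y\<close>.\<close>

lemma exchange:
  assumes ind: "indep2 w y" and sp: "\<And>v. \<exists>c d. v = x \<bullet> c + y \<bullet> d"
  shows "\<exists>c d. v = w \<bullet> c + y \<bullet> d"
proof -
  obtain a b where w: "w = x \<bullet> a + y \<bullet> b" using sp by blast
  have a: "a \<noteq> 0"
  proof
    assume "a = 0"
    then have "w \<bullet> 1 + y \<bullet> (- b) = 0" using w by (simp add: rscale_one)
    then show False using indep2_D[OF ind] by fastforce
  qed
  have x: "x = w \<bullet> inverse a + y \<bullet> (- (b * inverse a))"
    using a unfolding w by (simp add: add_rscale rscale_rscale rscale_one)
  obtain c d where "v = x \<bullet> c + y \<bullet> d" using sp by blast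
  then have "v = w \<bullet> (inverse a * c) + y \<bullet> (- (b * inverse a * c) + d)"
    by (subst (asm) x) (simp add: add_rscale diff_rscale rscale_diff rscale_rscale mult.assoc)
  then show ?thesis by blast
qed

lemma indep2_spans:
  assumes dim: "has_dimension 2" and ind: "indep2 x y"
  shows "\<exists>c d. v = x \<bullet> c + y \<bullet> d"
proof -
  obtain e f where ef: "indep2 e f" "\<And>v. \<exists>c d. v = e \<bullet> c + f \<bullet> d"
    using dimension_2_basis[OF dim] by blast
  \<comment> \<open>Two exchanges: \<open>x\<close> replaces \<open>e'\<close>, then
    \<open>y\<close> replaces \<open>f'\<close>. The case split below picks as \<open>f'\<close> a
    vector of the basis off the line of \<open>x\<close>.\<close>
  have main: "\<exists>c d. v = x \<bullet> c + y \<bullet> d" if "indep2 x f'" "\<And>v. \<exists>c d. v = e' \<bullet> c + f' \<bullet> d" for e' f' v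
  proof -
    have "\<exists>c d. v = f' \<bullet> c + x \<bullet> d" for v
      using exchange[OF that] by (metis add.commute)
    then have "\<exists>c d. v = y \<bullet> c + x \<bullet> d" for v
      by (rule exchange[OF indep2_sym[OF ind]])
    then show ?thesis by (metis add.commute)
  qed
  have x: "x \<noteq> 0" using indep2_nonzero[OF ind] by simp
  show ?thesis
  proof (cases "\<exists>q. f = x \<bullet> q")
    case False
    then show ?thesis using main[of f e] indep2_I[OF x] ef by blast
  next
    case True
    then obtain q where q: "f = x \<bullet> q" by blast
    have "e \<noteq> x \<bullet> r" for r
    proof
      assume r: "e = x \<bullet> r"
      have "q \<noteq> 0" using q indep2_nonzero[OF ef(1)] by auto
      then have "e \<bullet> 1 + f \<bullet> (- (inverse q * r)) = 0"
        by (simp add: q r rscale_rscale rscale_one flip: mult.assoc)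
      then show False using indep2_D[OF ef(1)] by fastforce
    qed
    then show ?thesis using main[of e f] indep2_I[OF x] ef by (metis add.commute)
  qed
qed

lemma indep2_extend:
  assumes dim: "has_dimension 2" and x: "x \<noteq> 0"
  obtains y where "indep2 x y"
proof -
  obtain e f where ef: "indep2 e f" using dim by (rule dimension_2_basis)
  have "\<not> ((\<exists>q. e = x \<bullet> q) \<and> (\<exists>r. f = x \<bullet> r))"
  proof safe
    fix q r assume qr: "e = x \<bullet> q" "f = x \<bullet> r"
    have "r \<noteq> 0" using qr indep2_nonzero[OF ef] by auto
    then have "e \<bullet> 1 + f \<bullet> (- (inverse r * q)) = 0"
      by (simp add: qr rscale_rscale rscale_one flip: mult.assoc)
    then show False using indep2_D[OF ef] by fastforce
  qed
  then show thesis using that indep2_I[OF x] by blast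
qed

text \<open>The projection onto the line of \<open>x\<close> along the line of
  \<open>y\<close>.\<close>

lemma indep2_projection:
  assumes dim: "has_dimension 2" and ind: "indep2 x y"
  obtains f where "endomorphism f" "f x = x" "f y = 0"
proof -
  obtain c d where cd: "\<And>v. v = x \<bullet> c v + y \<bullet> d v"
    using indep2_spans[OF dim ind] by metis
  have c_eq: "c (x \<bullet> a + y \<bullet> b) = a" for a b
    using indep2_coords[OF ind cd[of "x \<bullet> a + y \<bullet> b"]] by simp
  have "c (v + w) = c v + c w" for v w
  proof -
    have "v + w = x \<bullet> (c v + c w) + y \<bullet> (d v + d w)"
      using cd[of v] cd[of w] by (simp add: rscale_add algebra_simps)
    then show ?thesis by (metis c_eq)
  qed
  moreover have "c (v \<bullet> q) = c v * q" for v q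
  proof -
    have "v \<bullet> q = (x \<bullet> c v + y \<bullet> d v) \<bullet> q" using cd[of v] by simp
    also have "\<dots> = x \<bullet> (c v * q) + y \<bullet> (d v * q)"
      by (simp add: add_rscale rscale_rscale)
    finally show ?thesis by (metis c_eq)
  qed
  ultimately have "endomorphism (\<lambda>v. x \<bullet> c v)"
    by (simp add: endomorphism_def rscale_add rscale_rscale)
  moreover have "c x = 1" "c y = 0" using c_eq[of 1 0] c_eq[of 0 1] by (simp_all add: rscale_one)
  ultimately show thesis using that[of "\<lambda>v. x \<bullet> c v"] by (simp add: rscale_one)
qed

lemma endomorphism_eq_0:
  assumes "has_dimension 2" "indep2 x y" "endomorphism u" "u x = 0" "u y = 0"
  shows "u = (\<lambda>v. 0)"
proof
  fix v
  obtain c d where "v = x \<bullet> c + y \<bullet> d" using indep2_spans assms by blast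
  then show "u v = 0" using assms by (simp add: endomorphism_add endomorphism_rscale)
qed

section \<open>Swapped lines, zero diagonals and nilpotent summands\<close>

text \<open>The common form to which all three conditions are reduced. The coefficients may be zero,
  so a line may also be killed.\<close>

definition swaps_lines :: "('v \<Rightarrow> 'v) \<Rightarrow> 'v \<Rightarrow> 'v \<Rightarrow> bool"
  where "swaps_lines u x y \<longleftrightarrow> indep2 x y \<and> (\<exists>p. u x = y \<bullet> p) \<and> (\<exists>q. u y = x \<bullet> q)"

lemma zero_diagonal_iff:
  assumes dim: "has_dimension 2"
  shows "(\<exists>e m. is_basis 2 e \<and> is_matrix_of 2 e u m \<and> (\<forall>i<2. m i i = 0)) \<longleftrightarrow>
    (\<exists>x y. swaps_lines u x y)" (is "?L \<longleftrightarrow> ?R")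
proof
  assume ?L
  then obtain e m where e: "is_basis 2 e" "is_matrix_of 2 e u m" and m: "m 0 0 = 0" "m 1 1 = 0"
    by auto
  have "u (e 0) = e 1 \<bullet> m 1 0" "u (e 1) = e 0 \<bullet> m 0 1"
    using e(2) m by (simp_all add: is_matrix_of_def numeral_2_eq_2 less_Suc_eq)
  then show ?R using e(1) unfolding swaps_lines_def is_basis_2_iff by blast
next
  assume ?R
  then obtain x y p q where xy: "indep2 x y" "u x = y \<bullet> p" "u y = x \<bullet> q"
    unfolding swaps_lines_def by blast
  let ?e = "\<lambda>i::nat. if i = 0 then x else y"
  let ?m = "\<lambda>i j::nat. if i = j then 0 else if i = 0 then q else p"
  have "is_basis 2 ?e" using xy indep2_spans[OF dim xy(1)] by (simp add: is_basis_2_iff)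
  moreover have "is_matrix_of 2 ?e u ?m"
    using xy by (simp add: is_matrix_of_def numeral_2_eq_2 less_Suc_eq)
  ultimately show ?L by (intro exI[of _ ?e] exI[of _ ?m]) simp
qed

lemma funpow_eigenvector:
  assumes "endomorphism a" "a x = x \<bullet> q"
  shows "(a ^^ k) x = x \<bullet> q ^ k"
proof (induction k)
  case (Suc k)
  then show ?case using assms by (simp add: endomorphism_rscale rscale_rscale)
qed (simp add: rscale_one)

lemma nilpotent_image_in_kernel_line:
  assumes dim: "has_dimension 2" and a: "endomorphism a" "nilpotent a"
  obtains z where "z \<noteq> 0" "a z = 0" "\<And>v. \<exists>q. a v = z \<bullet> q"
proof -
  obtain k where k: "a ^^ k = (\<lambda>v. 0)" using a by (auto simp: nilpotent_def)
  obtain e f where "indep2 e f" using dim by (rule dimension_2_basis)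
  then have e: "e \<noteq> 0" using indep2_nonzero by blast
  have "\<exists>z. z \<noteq> 0 \<and> a z = 0"
  proof (rule ccontr)
    assume "\<nexists>z. z \<noteq> 0 \<and> a z = 0"
    then have "(a ^^ m) e \<noteq> 0" for m using e by (induction m) auto
    from this[of k] show False using k by simp
  qed
  then obtain z where z: "z \<noteq> 0" "a z = 0" by blast
  obtain w where w: "indep2 z w" using dim z(1) by (rule indep2_extend)
  obtain p r where aw: "a w = z \<bullet> p + w \<bullet> r" using indep2_spans[OF dim w] by blast
  have "r = 0"
  proof (rule ccontr)
    assume r: "r \<noteq> 0"
    \<comment> \<open>Chosen to be an eigenvector for \<open>r\<close>: the kernel vector
      \<open>z\<close> adjusts \<open>w\<close> without changing its image. Then
      \<open>a ^^ k\<close> acts on it by \<open>r ^ k\<close>, which is nonzero.\<close>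
    define w' where "w' = z \<bullet> (p * inverse r) + w \<bullet> 1"
    have "a w' = w' \<bullet> r"
      using r z by (simp add: w'_def endomorphism_add[OF a(1)] endomorphism_rscale[OF a(1)] aw
          add_rscale rscale_rscale rscale_one mult.assoc)
    then have "(a ^^ k) w' = w' \<bullet> r ^ k" by (rule funpow_eigenvector[OF a(1)])
    then have "w' = 0" using r k by simp
    then show False using indep2_D[OF w] unfolding w'_def by fastforce
  qed
  have "\<exists>q. a v = z \<bullet> q" for v
  proof -
    obtain c d where "v = z \<bullet> c + w \<bullet> d" using indep2_spans[OF dim w] by blast
    then have "a v = z \<bullet> (p * d)"
      using z aw \<open>r = 0\<close> by (simp add: endomorphism_add[OF a(1)] endomorphism_rscale[OF a(1)] rscale_rscale)
    then show ?thesis by blast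
  qed
  then show thesis using that z by blast
qed

lemma sum_of_nilpotents_iff:
  assumes dim: "has_dimension 2" and u: "endomorphism u"
  shows "(\<exists>a b. endomorphism a \<and> endomorphism b \<and> nilpotent a \<and> nilpotent b \<and> u = (\<lambda>x. a x + b x))
    \<longleftrightarrow> (\<exists>x y. swaps_lines u x y)" (is "?L \<longleftrightarrow> ?R")
proof
  assume ?L
  then obtain a b where a: "endomorphism a" "nilpotent a" and b: "endomorphism b" "nilpotent b"
    and ab: "u = (\<lambda>x. a x + b x)" by blast
  obtain x where x: "x \<noteq> 0" "a x = 0" "\<And>v. \<exists>q. a v = x \<bullet> q"
    using nilpotent_image_in_kernel_line[OF dim a] by blast
  obtain y where y: "y \<noteq> 0" "b y = 0" "\<And>v. \<exists>q. b v = y \<bullet> q"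
    using nilpotent_image_in_kernel_line[OF dim b] by blast
  show ?R
  proof (cases "\<exists>q. y = x \<bullet> q")
    case False
    then have "indep2 x y" using indep2_I[OF x(1)] by blast
    moreover have "\<exists>q. u x = y \<bullet> q" "\<exists>q. u y = x \<bullet> q" using x y ab by auto
    ultimately show ?R unfolding swaps_lines_def by blast
  next
    case True
    then obtain q where q: "y = x \<bullet> q" by blast
    then have q0: "q \<noteq> 0" using y by auto
    \<comment> \<open>When the two kernel lines coincide, \<open>u\<close> kills \<open>x\<close>
      and maps everything into its line, so any vector \<open>w\<close> completing \<open>x\<close>
      to an independent pair will do.\<close>
    obtain w where w: "indep2 x w" using dim x(1) by (rule indep2_extend)
    have "b x \<bullet> q = 0" using y q by (simp flip: endomorphism_rscale[OF b(1)])
    then have "u x = w \<bullet> 0" using ab x q0 by simp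
    moreover obtain r s where "a w = x \<bullet> r" "b w = x \<bullet> q \<bullet> s" using x y q by metis
    then have "u w = x \<bullet> (r + q * s)" by (simp add: ab rscale_add rscale_rscale)
    ultimately show ?R using w unfolding swaps_lines_def by blast
  qed
next
  assume ?R
  then obtain x y p q where xy: "indep2 x y" "u x = y \<bullet> p" "u y = x \<bullet> q"
    unfolding swaps_lines_def by blast
  \<comment> \<open>Composing \<open>u\<close> with the two projections separates the two
    off-diagonal entries of its matrix; each of the resulting maps has square zero.\<close>
  obtain f where f: "endomorphism f" "f x = x" "f y = 0" using indep2_projection[OF dim xy(1)] by blast
  obtain g where g: "endomorphism g" "g y = y" "g x = 0"
    using indep2_projection[OF dim indep2_sym[OF xy(1)]] by blast
  have nil: "nilpotent h" if "endomorphism h" "h (h x) = 0" "h (h y) = 0" for h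
  proof -
    have "h \<circ> h = (\<lambda>v. 0)" using that by (intro endomorphism_eq_0[OF dim xy(1)] endomorphism_comp) auto
    then have "h ^^ 2 = (\<lambda>v. 0)" by (simp add: numeral_2_eq_2)
    then show ?thesis unfolding nilpotent_def by blast
  qed
  have uf: "endomorphism (u \<circ> f)" and ug: "endomorphism (u \<circ> g)"
    using u f g endomorphism_comp by blast+
  have "nilpotent (u \<circ> f)"
    using xy f u by (intro nil uf) (simp_all add: endomorphism_rscale endomorphism_0)
  moreover have "nilpotent (u \<circ> g)"
    using xy g u by (intro nil ug) (simp_all add: endomorphism_rscale endomorphism_0)
  moreover have "u = (\<lambda>v. (u \<circ> f) v + (u \<circ> g) v)"
  proof
    fix v
    obtain c d where "v = x \<bullet> c + y \<bullet> d" using indep2_spans[OF dim xy(1)] by blast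
    then have "f v + g v = v" using f g by (simp add: endomorphism_add endomorphism_rscale)
    then show "u v = (u \<circ> f) v + (u \<circ> g) v" by (simp flip: endomorphism_add[OF u])
  qed
  ultimately show ?L using uf ug by blast
qed

section \<open>Eigenbases with a single eigenvalue\<close>

text \<open>Asks for one eigenvalue \<open>p\<close> instead of two conjugate ones, since rescaling
  an eigenvector moves its eigenvalue through the whole conjugacy class.\<close>

definition eigenbasis :: "('v \<Rightarrow> 'v) \<Rightarrow> 'v \<Rightarrow> 'v \<Rightarrow> 'q \<Rightarrow> bool"
  where "eigenbasis w x y p \<longleftrightarrow> indep2 x y \<and> w x = x \<bullet> p \<and> w y = y \<bullet> p"

lemma eigenvector_conj:
  assumes "endomorphism w" "w x = x \<bullet> q" "s \<noteq> 0"
  shows "w (x \<bullet> inverse s) = x \<bullet> inverse s \<bullet> (s * q * inverse s)"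
  using assms by (simp add: endomorphism_rscale rscale_rscale flip: mult.assoc)

lemma eigenbasis_conj:
  assumes "endomorphism w" "eigenbasis w x y q" "s \<noteq> 0"
  shows "eigenbasis w (x \<bullet> inverse s) (y \<bullet> inverse s) (s * q * inverse s)"
  using assms by (simp add: eigenbasis_def eigenvector_conj indep2_rscale)

text \<open>Comparing coordinates in \<open>w v = v \<bullet> q\<close> shows that each nonzero
  coordinate of \<open>v\<close> conjugates \<open>p\<close> into \<open>q\<close>; the converse is
  rescaling.\<close>

lemma eigenbasis_eigenvalues:
  assumes dim: "has_dimension 2" and w: "endomorphism w" and b: "eigenbasis w x y p"
  shows "eigenvalues w = conj_class p"
proof safe
  fix q assume "q \<in> eigenvalues w"
  then obtain v where v: "v \<noteq> 0" "w v = v \<bullet> q" by (auto simp: eigenvalues_def)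
  have ind: "indep2 x y" using b by (simp add: eigenbasis_def)
  obtain c d where cd: "v = x \<bullet> c + y \<bullet> d" using indep2_spans[OF dim ind] by blast
  have "x \<bullet> (p * c) + y \<bullet> (p * d) = x \<bullet> (c * q) + y \<bullet> (d * q)"
    using v b w by (simp add: cd eigenbasis_def endomorphism_add endomorphism_rscale add_rscale rscale_rscale)
  then have pc: "p * c = c * q" "p * d = d * q" using indep2_coords[OF ind] by blast+
  have *: "q \<in> conj_class p" if "s \<noteq> 0" "p * s = s * q" for s
  proof -
    have "inverse s * (p * s) = q" using that by (simp flip: mult.assoc)
    then have "q = inverse s * p * inverse (inverse s)" using that by (simp add: mult.assoc)
    then show ?thesis using that unfolding conj_class_def by (metis (mono_tags, lifting) inverse_nonzero_iff_nonzero mem_Collect_eq)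
  qed
  have "c \<noteq> 0 \<or> d \<noteq> 0" using v cd by auto
  then show "q \<in> conj_class p" using * pc by blast
next
  fix q assume "q \<in> conj_class p"
  then obtain s where s: "s \<noteq> 0" "q = s * p * inverse s" by (auto simp: conj_class_def)
  have "eigenbasis w (x \<bullet> inverse s) (y \<bullet> inverse s) q" using eigenbasis_conj[OF w b s(1)] s by simp
  then show "q \<in> eigenvalues w" using indep2_nonzero by (auto simp: eigenvalues_def eigenbasis_def)
qed

lemma unispectral_diagonalisable_iff:
  assumes dim: "has_dimension 2" and w: "endomorphism w"
  shows "unispectral w \<and> diagonalisable w \<longleftrightarrow> (\<exists>x y p. eigenbasis w x y p)" (is "?L \<longleftrightarrow> ?R")
proof
  assume ?R
  then obtain x y p where b: "eigenbasis w x y p" by blast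
  let ?e = "\<lambda>i::nat. if i = 0 then x else y"
  have ind: "indep2 x y" using b by (simp add: eigenbasis_def)
  have "is_basis 2 ?e" using ind indep2_spans[OF dim ind] by (simp add: is_basis_2_iff)
  moreover have "\<forall>i<2. eigenvector w (?e i)"
    using b indep2_nonzero[OF ind] by (auto simp: eigenvector_def eigenbasis_def)
  ultimately have "diagonalisable w" unfolding diagonalisable_def by blast
  moreover have "unispectral w" using eigenbasis_eigenvalues[OF dim w b] unfolding unispectral_def by blast
  ultimately show ?L by simp
next
  assume L: ?L
  then obtain p where p: "eigenvalues w = conj_class p" by (auto simp: unispectral_def)
  obtain n e where e: "is_basis n e" "\<And>i. i < n \<Longrightarrow> eigenvector w (e i)"
    using L by (auto simp: diagonalisable_def)
  obtain x y where xy: "indep2 x y" using dim by (rule dimension_2_basis)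
  \<comment> \<open>Diagonalisability provides an eigenbasis of unspecified length. With at most one
    vector the plane would lie in the line of \<open>e 0\<close>; with two or more,
    \<open>e 0\<close> and \<open>e 1\<close> form the independent pair.\<close>
  have n: "n \<ge> 2"
  proof (rule ccontr)
    assume "\<not> n \<ge> 2"
    have "\<exists>q. v = e 0 \<bullet> q" for v
    proof -
      obtain c where v: "v = (\<Sum>i<n. e i \<bullet> c i)" using e unfolding is_basis_def by blast
      consider "n = 0" | "n = 1" using \<open>\<not> n \<ge> 2\<close> by linarith
      then show ?thesis
        by cases (use v in \<open>auto intro: exI[of _ 0]\<close>)
    qed
    then obtain q r where qr: "x = e 0 \<bullet> q" "y = e 0 \<bullet> r" by metis
    have "r \<noteq> 0" using qr indep2_nonzero[OF xy] by auto
    then have "x \<bullet> 1 + y \<bullet> (- (inverse r * q)) = 0"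
      by (simp add: qr rscale_rscale rscale_one flip: mult.assoc)
    then show False using indep2_D[OF xy] by fastforce
  qed
  have e_ind: "\<forall>i<n. c i = 0" if "(\<Sum>i<n. e i \<bullet> c i) = 0" for c
    using e(1) that unfolding is_basis_def by blast
  have ind: "indep2 (e 0) (e 1)"
    unfolding indep2_def
  proof (intro allI impI)
    fix a b assume 0: "e 0 \<bullet> a + e 1 \<bullet> b = 0"
    let ?c = "\<lambda>i::nat. if i = 0 then a else if i = 1 then b else 0"
    have "(\<Sum>i<n. e i \<bullet> ?c i) = (\<Sum>i<2. e i \<bullet> ?c i)"
      using n by (intro sum.mono_neutral_right) auto
    also have "\<dots> = 0" using 0 by (simp add: numeral_2_eq_2)
    finally have "\<forall>i<n. ?c i = 0" by (rule e_ind)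
    from this[rule_format, of 0] this[rule_format, of 1] show "a = 0 \<and> b = 0"
      using n by simp
  qed
  \<comment> \<open>Each eigenvalue is conjugate to \<open>p\<close>, and rescaling by the
    conjugating element turns it into \<open>p\<close> itself.\<close>
  have "\<exists>s. s \<noteq> 0 \<and> w (e i \<bullet> s) = e i \<bullet> s \<bullet> p" if i: "i < n" for i
  proof -
    obtain q where q: "e i \<noteq> 0" "w (e i) = e i \<bullet> q" using e(2)[OF i] by (auto simp: eigenvector_def)
    then have "q \<in> conj_class p" using p by (auto simp: eigenvalues_def)
    then obtain s where s: "s \<noteq> 0" "q = s * p * inverse s" by (auto simp: conj_class_def)
    then have "w (e i \<bullet> s) = e i \<bullet> s \<bullet> p"
      using q w by (simp add: endomorphism_rscale rscale_rscale mult.assoc)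
    then show ?thesis using s by blast
  qed
  then obtain s t where "s \<noteq> 0" "t \<noteq> 0" "w (e 0 \<bullet> s) = e 0 \<bullet> s \<bullet> p" "w (e 1 \<bullet> t) = e 1 \<bullet> t \<bullet> p"
    using n by (metis less_le_trans one_less_numeral_iff pos2 semiring_norm(76))
  then have "eigenbasis w (e 0 \<bullet> s) (e 1 \<bullet> t) p"
    using ind by (simp add: eigenbasis_def indep2_rscale)
  then show ?R by blast
qed

lemma swaps_lines_eigenbasis_square:
  assumes u: "endomorphism u" and s: "swaps_lines u x y"
  shows "\<exists>x y p. eigenbasis (u \<circ> u) x y p"
proof -
  obtain c b where cb: "indep2 x y" "u x = y \<bullet> c" "u y = x \<bullet> b" using s by (auto simp: swaps_lines_def)
  note u_simps = endomorphism_rscale[OF u] rscale_rscale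
  show ?thesis
  proof (cases "c = 0")
    case True
    then have "eigenbasis (u \<circ> u) x y 0" using cb by (simp add: eigenbasis_def u_simps endomorphism_0[OF u])
    then show ?thesis by blast
  next
    case False
    \<comment> \<open>Passing from \<open>y\<close> to \<open>y \<bullet> c\<close> turns its
      eigenvalue \<open>c * b\<close> under \<open>u \<circ> u\<close> into \<open>b * c\<close>,
      the eigenvalue of \<open>x\<close>.\<close>
    then have "indep2 x (y \<bullet> c)" using indep2_rscale[OF cb(1), of 1 c] by (simp add: rscale_one)
    then have "eigenbasis (u \<circ> u) x (y \<bullet> c) (b * c)" using cb by (simp add: eigenbasis_def u_simps mult.assoc)
    then show ?thesis by blast
  qed
qed

lemma no_swap_eigenvector:
  assumes u: "endomorphism u" and no: "\<nexists>x y. swaps_lines u x y" and v: "(u \<circ> u) v = v \<bullet> p"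
  shows "\<exists>q. u v = v \<bullet> q"
proof (rule ccontr)
  assume n: "\<nexists>q. u v = v \<bullet> q"
  then have "v \<noteq> 0" using endomorphism_0[OF u] by auto
  then have "indep2 v (u v)" using n by (intro indep2_I) auto
  moreover have "u v = u v \<bullet> 1" by (simp add: rscale_one)
  ultimately have "swaps_lines u v (u v)" using v unfolding swaps_lines_def comp_def by blast
  then show False using no by blast
qed

end

section \<open>The quaternionic plane\<close>

locale quaternionic_plane =
  quaternion_division_algebra scale + right_vector_space rscale
  for scale :: "'f::field \<Rightarrow> 'q::division_ring \<Rightarrow> 'q"
    and rscale :: "'v::ab_group_add \<Rightarrow> 'q \<Rightarrow> 'v"  (infixl "\<bullet>" 75) +
  assumes dim: "has_dimension 2"
begin

text \<open>
  An operator with an eigenbasis for \<open>q\<close> satisfies \<open>u\<^sup>2 = t u - n\<close> with \<open>t\<close> and \<open>n\<close> the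
  trace and norm of \<open>q\<close>; on swapped lines this forces \<open>t u = 0\<close>. Comparing the traces of
  the two matrices of \<open>u\<close> would only give \<open>2 t = 0\<close>.
\<close>

lemma swaps_lines_eigenbasis:
  assumes u: "endomorphism u" "u \<noteq> (\<lambda>v. 0)" and s: "swaps_lines u x y" and e: "eigenbasis u x' y' q"
  shows "noncentral q \<and> pure q"
proof -
  obtain b c where xy: "indep2 x y" and ux: "u x = y \<bullet> c" and uy: "u y = x \<bullet> b"
    using s by (auto simp: swaps_lines_def)
  have e': "indep2 x' y'" "u x' = x' \<bullet> q" "u y' = y' \<bullet> q"
    using e by (auto simp: eigenbasis_def)
  note u_simps = endomorphism_add[OF u(1)] endomorphism_rscale[OF u(1)]
  have bc: "b \<noteq> 0 \<or> c \<noteq> 0" using endomorphism_eq_0[OF dim xy u(1)] u(2) ux uy by auto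
  define t where "t = q + qconj q"
  define n where "n = q * qconj q"
  have t: "t \<in> scalars" unfolding t_def by (rule conjugation_trace[OF is_conjugation_qconj])
  have n: "n \<in> scalars" using is_conjugation_qconj unfolding n_def is_conjugation_def by blast
  have qq: "q * q = q * t - n" by (simp add: t_def n_def distrib_left)
  have uu: "u (u v) + v \<bullet> n = u v \<bullet> t" for v
  proof -
    \<comment> \<open>\<open>q * q = q * t - n\<close> applied to a coordinate \<open>d\<close>:
      being central, \<open>n\<close> and \<open>t\<close> can be moved to the right of
      \<open>d\<close>, where scaling of vectors puts them.\<close>
    have *: "q * (q * d) + d * n = q * (d * t)" for d
      using scalars_commute[OF n, of d] scalars_commute[OF t, of d] qq
      by (simp add: left_diff_distrib flip: mult.assoc) (simp add: mult.assoc)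
    obtain c d where "v = x' \<bullet> c + y' \<bullet> d" using indep2_spans[OF dim e'(1)] by blast
    then have "u (u v) + v \<bullet> n = x' \<bullet> (q * (q * c) + c * n) + y' \<bullet> (q * (q * d) + d * n)"
      by (simp add: u_simps e' add_rscale rscale_add rscale_rscale)
    also have "\<dots> = u v \<bullet> t"
      unfolding * \<open>v = x' \<bullet> c + y' \<bullet> d\<close> by (simp add: u_simps e' add_rscale rscale_rscale mult.assoc)
    finally show ?thesis .
  qed
  have "x \<bullet> (b * c + n) + y \<bullet> 0 = x \<bullet> 0 + y \<bullet> (c * t)"
    using uu[of x] by (simp add: ux uy u_simps rscale_add rscale_rscale)
  then have "c * t = 0" using indep2_coords[OF xy] by metis
  moreover have "x \<bullet> 0 + y \<bullet> (c * b + n) = x \<bullet> (b * t) + y \<bullet> 0"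
    using uu[of y] by (simp add: ux uy u_simps rscale_add rscale_rscale)
  then have "b * t = 0" using indep2_coords[OF xy] by metis
  ultimately have "t = 0" using bc by auto
  then have "pure q" by (simp add: pure_def reduced_trace_def t_def)
  moreover have "q \<notin> scalars"
  proof
    assume q: "q \<in> scalars"
    \<comment> \<open>A central \<open>q\<close> would make \<open>u\<close> the scaling by
      \<open>q\<close>; comparing this with the swapped lines gives
      \<open>b = c = 0\<close>.\<close>
    have uq: "u v = v \<bullet> q" for v
    proof -
      obtain c d where "v = x' \<bullet> c + y' \<bullet> d" using indep2_spans[OF dim e'(1)] by blast
      then show ?thesis
        using scalars_commute[OF q] by (simp add: u_simps e' add_rscale rscale_rscale)
    qed
    have "x \<bullet> q + y \<bullet> 0 = x \<bullet> 0 + y \<bullet> c" "x \<bullet> 0 + y \<bullet> q = x \<bullet> b + y \<bullet> 0" using uq ux uy by auto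
    then have "b = 0" "c = 0" using indep2_coords[OF xy] by metis+
    then show False using bc by simp
  qed
  ultimately show ?thesis by (simp add: noncentral_def)
qed

text \<open>Conjugation negates a pure \<open>q\<close>, so \<open>- (q * q)\<close> is its
  norm.\<close>

lemma pure_square_in_scalars:
  assumes "pure q"
  shows "q * q \<in> scalars"
proof -
  have "qconj q = - q" using assms by (simp add: pure_def reduced_trace_def eq_neg_iff_add_eq_0 add.commute)
  then have "- (q * q) \<in> scalars" using is_conjugation_qconj unfolding is_conjugation_def by (metis mult_minus_right)
  then show ?thesis by (simp add: scalars_iff)
qed

text \<open>The assumption \<open>pure\<close> is the last clause of condition (iii), stated for
  eigenbases.\<close>

lemma eigenbasis_square_swaps_lines:
  assumes u: "endomorphism u" and e: "eigenbasis (u \<circ> u) x y p"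
    and pure: "\<And>x y q. eigenbasis u x y q \<Longrightarrow> u \<noteq> (\<lambda>v. 0) \<Longrightarrow> noncentral q \<and> pure q"
  shows "\<exists>x y. swaps_lines u x y"
proof (rule ccontr)
  assume no: "\<nexists>x y. swaps_lines u x y"
  have xy: "indep2 x y" and uu: "(u \<circ> u) x = x \<bullet> p" "(u \<circ> u) y = y \<bullet> p" using e by (auto simp: eigenbasis_def)
  note u_simps = endomorphism_add[OF u] endomorphism_rscale[OF u]
  \<comment> \<open>Without swapped lines, \<open>x\<close>, \<open>y\<close> and
    \<open>x + y\<close> are all eigenvectors of \<open>u\<close>; the third one forces the
    eigenvalues on \<open>x\<close> and \<open>y\<close> to agree.\<close>
  have "(u \<circ> u) (x + y) = (x + y) \<bullet> p" using uu by (simp add: u_simps add_rscale)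
  then obtain a b r where abr: "u x = x \<bullet> a" "u y = y \<bullet> b" "u (x + y) = (x + y) \<bullet> r"
    using no_swap_eigenvector[OF u no] uu by metis
  then have "x \<bullet> a + y \<bullet> b = x \<bullet> r + y \<bullet> r" by (simp add: u_simps add_rscale)
  then have "a = r" "b = r" using indep2_coords[OF xy] by metis+
  then have r: "eigenbasis u x y r" "u x = x \<bullet> r" "u y = y \<bullet> r" using abr xy by (auto simp: eigenbasis_def)
  have "u \<noteq> (\<lambda>v. 0)"
  proof
    assume "u = (\<lambda>v. 0)"
    then have "u x = y \<bullet> 0" "u y = x \<bullet> 0" by simp_all
    then show False using no xy unfolding swaps_lines_def by blast
  qed
  then have rp: "r \<notin> scalars" "r * r \<in> scalars"
    using pure[OF r(1)] pure_square_in_scalars by (auto simp: noncentral_def)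
  \<comment> \<open>Centrality of \<open>r * r\<close> makes \<open>x + y \<bullet> s\<close> an
    eigenvector of \<open>u \<circ> u\<close>, hence of \<open>u\<close>. Its coordinates then give
    \<open>q = r\<close> and \<open>r * s = s * q\<close>, against the choice of
    \<open>s\<close>.\<close>
  then obtain s where s: "r * s \<noteq> s * r" by (auto simp: scalars_iff)
  have "(u \<circ> u) (x + y \<bullet> s) = (x + y \<bullet> s) \<bullet> (r * r)"
    using r scalars_commute[OF rp(2), of s] by (simp add: u_simps add_rscale rscale_rscale mult.assoc)
  then obtain q where "u (x + y \<bullet> s) = (x + y \<bullet> s) \<bullet> q" using no_swap_eigenvector[OF u no] by blast
  then have "x \<bullet> r + y \<bullet> (r * s) = x \<bullet> q + y \<bullet> (s * q)"
    using r by (simp add: u_simps add_rscale rscale_rscale)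
  then show False using indep2_coords[OF xy] s by metis
qed

lemma swaps_lines_iff:
  assumes u: "endomorphism u"
  shows "(\<exists>x y. swaps_lines u x y) \<longleftrightarrow>
    unispectral (u \<circ> u) \<and> diagonalisable (u \<circ> u) \<and>
    (unispectral u \<and> diagonalisable u \<longrightarrow>
      u = (\<lambda>v. 0) \<or> (\<forall>q \<in> eigenvalues u. noncentral q \<and> pure q))"
    (is "?L \<longleftrightarrow> ?R")
proof -
  have square: "unispectral (u \<circ> u) \<and> diagonalisable (u \<circ> u) \<longleftrightarrow> (\<exists>x y p. eigenbasis (u \<circ> u) x y p)"
    by (intro unispectral_diagonalisable_iff dim endomorphism_comp u)
  \<comment> \<open>Once one eigenbasis exists, every eigenvalue has an eigenbasis of its own, by
    rescaling. The clause on eigenvalues thus becomes one on eigenbases.\<close>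
  have eig: "(\<forall>q \<in> eigenvalues u. P q) \<longleftrightarrow> (\<forall>x y q. eigenbasis u x y q \<longrightarrow> P q)"
    if e: "eigenbasis u x y p" for x y p and P :: "'q \<Rightarrow> bool"
  proof -
    have "q \<in> eigenvalues u \<longleftrightarrow> (\<exists>x y. eigenbasis u x y q)" for q
    proof
      assume "q \<in> eigenvalues u"
      then obtain s where "s \<noteq> 0" "q = s * p * inverse s"
        using eigenbasis_eigenvalues[OF dim u e] by (auto simp: conj_class_def)
      then show "\<exists>x y. eigenbasis u x y q" using eigenbasis_conj[OF u e] by blast
    next
      assume "\<exists>x y. eigenbasis u x y q"
      then show "q \<in> eigenvalues u"
        using indep2_nonzero by (auto simp: eigenvalues_def eigenbasis_def)
    qed
    then show ?thesis by blast
  qed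
  show ?thesis
  proof
    assume ?L
    then obtain x y where s: "swaps_lines u x y" by blast
    have "u = (\<lambda>v. 0) \<or> (\<forall>q \<in> eigenvalues u. noncentral q \<and> pure q)"
      if ud: "unispectral u \<and> diagonalisable u"
    proof -
      obtain x' y' p where e: "eigenbasis u x' y' p"
        using ud unispectral_diagonalisable_iff[OF dim u] by blast
      show ?thesis unfolding eig[OF e] using swaps_lines_eigenbasis[OF u _ s] by blast
    qed
    then show ?R using square swaps_lines_eigenbasis_square[OF u s] by blast
  next
    assume R: ?R
    then obtain x y p where e: "eigenbasis (u \<circ> u) x y p" using square by blast
    show ?L
    proof (rule eigenbasis_square_swaps_lines[OF u e])
      fix x y q assume b: "eigenbasis u x y q" "u \<noteq> (\<lambda>v. 0)"
      then have "unispectral u \<and> diagonalisable u" using unispectral_diagonalisable_iff[OF dim u] by blast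
      then have "\<forall>q \<in> eigenvalues u. noncentral q \<and> pure q" using R b(2) by blast
      then show "noncentral q \<and> pure q" unfolding eig[OF b(1)] using b(1) by blast
    qed
  qed
qed

end

theorem theorem3p2:
  fixes scale :: "'f::field \<Rightarrow> 'q::division_ring \<Rightarrow> 'q"
    and rscale :: "'v::ab_group_add \<Rightarrow> 'q \<Rightarrow> 'v"
    and u :: "'v \<Rightarrow> 'v"
  assumes Q: "quaternion_division_algebra scale"
    and V: "right_vector_space rscale"
    and dim: "right_vector_space.has_dimension rscale 2"
    and u: "right_vector_space.endomorphism rscale u"
  defines "cond_i \<equiv> \<exists>a b. right_vector_space.endomorphism rscale a \<and>
        right_vector_space.endomorphism rscale b \<and>
        nilpotent a \<and> nilpotent b \<and> u = (\<lambda>x. a x + b x)"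
    and "cond_ii \<equiv> \<exists>e m. right_vector_space.is_basis rscale 2 e \<and>
        right_vector_space.is_matrix_of rscale 2 e u m \<and> (\<forall>i<2. m i i = 0)"
    and "cond_iii \<equiv>
        right_vector_space.unispectral rscale (u \<circ> u) \<and>
        right_vector_space.diagonalisable rscale (u \<circ> u) \<and>
        (right_vector_space.unispectral rscale u \<and> right_vector_space.diagonalisable rscale u
          \<longrightarrow> u = (\<lambda>x. 0) \<or>
            (\<forall>q \<in> right_vector_space.eigenvalues rscale u.
              quaternion_division_algebra.noncentral scale q \<and>
              quaternion_division_algebra.pure scale q))"
  shows "(cond_i \<longleftrightarrow> cond_ii) \<and> (cond_ii \<longleftrightarrow> cond_iii)"
proof -
  interpret quaternionic_plane scale rscale
    using Q V dim by (intro quaternionic_plane.intro quaternionic_plane_axioms.intro)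
  have "cond_i \<longleftrightarrow> (\<exists>x y. swaps_lines u x y)"
    unfolding cond_i_def by (rule sum_of_nilpotents_iff[OF dim u])
  moreover have "cond_ii \<longleftrightarrow> (\<exists>x y. swaps_lines u x y)"
    unfolding cond_ii_def by (rule zero_diagonal_iff[OF dim])
  moreover have "cond_iii \<longleftrightarrow> (\<exists>x y. swaps_lines u x y)"
    unfolding cond_iii_def by (rule swaps_lines_iff[OF u, symmetric])
  ultimately show ?thesis by blast
qed

end
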